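(* Let $\widetilde x=\{x_\alpha\}_{\alpha\in(0,1]}$ be a fuzzy vector, and let $g:(0,1]\to(0,1]$ be a strictly increasing bijection. Define a reparameterized fuzzy vector $\widetilde y=\{y_t\}_{t\in(0,1]}$ by $y_t=x_{g(t)}$ for $t\in(0,1]$. For every $\alpha\in(0,1]$ define $$\widetilde Y_\alpha=\operatorname{span}\{y_t:t\in[\alpha,1]\},\qquad \widetilde X_\alpha=\operatorname{span}\{x_\beta:\beta\in[\alpha,1]\}.$$ Then $\widetilde Y_\alpha=\widetilde X_{g(\alpha)}$ for every $\alpha\in(0,1]$. Consequently $$\{\widetilde Y_\alpha:\alpha\in(0,1]\}=\{\widetilde X_\alpha:\alpha\in(0,1]\},$$ that is, the family of tail spaces is invariant under every monotone reparameterization of the level parameter. Consequently, every structural property depending only on the nested family $\{\widetilde X_\alpha\}_{\alpha\in(0,1]}$ is invariant under monotone reparameterization. In particular, the dimension profile $\delta(\alpha)=\dim(\widetilde X_\alpha)$ is preserved up to composition with the change of parameter: $\delta_Y(\alpha)=\delta_X(g(\alpha))$, where $\delta_X(\alpha)=\dim(\widetilde X_\alpha)$ and $\delta_Y(\alpha)=\dim(\widetilde Y_\alpha)$. Hence the set of critical levels at which the dimension changes is an order-theoretic invariant.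
   Context: Let $V$ be a vector space over $\mathbb R$ or $\mathbb C$ and $X$ a vector subspace of $V$. A fuzzy labeling on $X$ is a map $(0,1]\times X\to V$, $(\alpha,x)\mapsto x_\alpha$, with $x_1=x$ for all $x\in X$. For $x\in X$, the family $\widetilde x=\{x_\alpha\}_{\alpha\in(0,1]}$ is called the fuzzy vector associated with $x$. The spaces $\widetilde X_\alpha$ are called tail spaces; they are nested, $\widetilde X_{\alpha_2}\subseteq\widetilde X_{\alpha_1}$ for $\alpha_1<\alpha_2$. The phrase "order-theoretic invariant" is used informally, for something depending only on the ordering of the levels and not on their particular numerical parametrization. *)

theory Defs
  imports Complex_Main
begin

unbundle cardinal_syntax

text \<open>
  The ambient space \<open>V\<close> is the type \<open>'v\<close> with scalar multiplication \<open>scale\<close>, assumed to satisfy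
  \<^locale>\<open>vector_space\<close> where the notions are used. The level interval \<open>(0,1]\<close> is
  \<open>{0<..1::real}\<close>; values of a labeling outside \<open>(0,1] \<times> X\<close> are irrelevant.
  By the Gelfand-Mazur theorem the models of \<^class>\<open>real_normed_field\<close>, the scalars of the main
  theorem, are exactly the real and the complex numbers.
\<close>

definition fuzzy_labeling ::
    "('k::field \<Rightarrow> 'v::ab_group_add \<Rightarrow> 'v) \<Rightarrow> 'v set \<Rightarrow> (real \<Rightarrow> 'v \<Rightarrow> 'v) \<Rightarrow> bool" where
  "fuzzy_labeling scale X lab \<longleftrightarrow> module.subspace scale X \<and> (\<forall>x\<in>X. lab 1 x = x)"

definition fuzzy_vector ::
    "('k::field \<Rightarrow> 'v::ab_group_add \<Rightarrow> 'v) \<Rightarrow> 'v set \<Rightarrow> (real \<Rightarrow> 'v) \<Rightarrow> bool" where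
  "fuzzy_vector scale X u \<longleftrightarrow>
     (\<exists>lab x. fuzzy_labeling scale X lab \<and> x \<in> X \<and> (\<forall>\<alpha>\<in>{0<..1}. u \<alpha> = lab \<alpha> x))"

definition tail_space ::
    "('k::field \<Rightarrow> 'v::ab_group_add \<Rightarrow> 'v) \<Rightarrow> (real \<Rightarrow> 'v) \<Rightarrow> real \<Rightarrow> 'v set" where
  "tail_space scale u \<alpha> = module.span scale (u ` {\<alpha>..1})"

definition tail_family ::
    "('k::field \<Rightarrow> 'v::ab_group_add \<Rightarrow> 'v) \<Rightarrow> (real \<Rightarrow> 'v) \<Rightarrow> 'v set set" where
  "tail_family scale u = tail_space scale u ` {0<..1}"

text \<open>
  The library's \<^const>\<open>vector_space.dim\<close> is a natural number and is 0 on infinite-dimensional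
  subspaces. Tail spaces may be infinite-dimensional, so the dimension is taken to be the cardinal
  of a basis; such cardinals are compared by \<open>=o\<close>, not by equality of the representing well-orders.
\<close>

definition cdim :: "('k::field \<Rightarrow> 'v::ab_group_add \<Rightarrow> 'v) \<Rightarrow> 'v set \<Rightarrow> 'v rel" where
  "cdim scale S = |SOME B. \<not> module.dependent scale B \<and> module.span scale B = S|"

lemma (in vector_space) cdim_eq_card_of_basis:
  assumes "independent B" and "span B = S"
  shows "cdim scale S =o |B|"
proof -
  let ?C = "SOME B. independent B \<and> span B = S"
  have "independent ?C \<and> span ?C = S"
    using assms by (intro someI[of "\<lambda>B. independent B \<and> span B = S" B]) simp
  then obtain f where "bij_betw f ?C B"
    using bij_if_span_eq_span_bases[of ?C B] assms by auto
  then show ?thesis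
    unfolding cdim_def using card_of_ordIsoI by blast
qed

definition dim_profile ::
    "('k::field \<Rightarrow> 'v::ab_group_add \<Rightarrow> 'v) \<Rightarrow> (real \<Rightarrow> 'v) \<Rightarrow> real \<Rightarrow> 'v rel" where
  "dim_profile scale u \<alpha> = cdim scale (tail_space scale u \<alpha>)"

text \<open>
  A level is critical if the dimension profile is not locally constant there, in the topology
  of \<open>(0,1]\<close>; a change on either side counts.
\<close>

definition critical_levels ::
    "('k::field \<Rightarrow> 'v::ab_group_add \<Rightarrow> 'v) \<Rightarrow> (real \<Rightarrow> 'v) \<Rightarrow> real set" where
  "critical_levels scale u =
     {\<alpha>\<in>{0<..1}. \<not> (\<forall>\<^sub>F \<beta> in at \<alpha> within {0<..1}.
        dim_profile scale u \<beta> =o dim_profile scale u \<alpha>)}"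

end

theory Submission
  imports Defs
begin

text \<open>
  An increasing bijection of \<open>(0,1]\<close> maps \<open>[\<alpha>,1]\<close> onto \<open>[g \<alpha>,1]\<close>, so both tail spaces are spans of
  the same set. It is also a homeomorphism of \<open>(0,1]\<close>, so local constancy of the dimension profile at
  \<open>\<alpha>\<close> and at \<open>g \<alpha>\<close> are equivalent.
\<close>

lemma continuous_on_strict_mono_interval_image:
  fixes f :: "'a::linorder_topology \<Rightarrow> 'b::linorder_topology"
  assumes mono: "strict_mono_on S f"
    and interval: "\<And>u v w. u \<in> f ` S \<Longrightarrow> w \<in> f ` S \<Longrightarrow> u \<le> v \<Longrightarrow> v \<le> w \<Longrightarrow> v \<in> f ` S"
  shows "continuous_on S f"
  unfolding continuous_on_def
proof (intro ballI order_tendstoI)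
  fix a l assume a: "a \<in> S" and l: "l < f a"
  show "\<forall>\<^sub>F b in at a within S. l < f b"
  proof (cases "l \<in> f ` S")
    case True
    then obtain c where c: "c \<in> S" "l = f c" by auto
    with a l mono have "c < a"
      by (simp add: strict_mono_on_less)
    then have "\<forall>\<^sub>F b in at a within S. c < b"
      by (rule order_tendstoD(1)[OF tendsto_ident_at])
    moreover have "\<forall>\<^sub>F b in at a within S. b \<in> S"
      by (simp add: eventually_at_filter)
    ultimately show ?thesis
      by eventually_elim (use c mono in \<open>simp add: strict_mono_on_less\<close>)
  next
    case False
    then have "l < f b" if "b \<in> S" for b
      using interval[of "f b" "f a" l] that a l by force
    then show ?thesis
      by (simp add: eventually_at_filter)
  qed
next
  fix a u assume a: "a \<in> S" and u: "f a < u"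
  show "\<forall>\<^sub>F b in at a within S. f b < u"
  proof (cases "u \<in> f ` S")
    case True
    then obtain c where c: "c \<in> S" "u = f c" by auto
    with a u mono have "a < c"
      by (simp add: strict_mono_on_less)
    then have "\<forall>\<^sub>F b in at a within S. b < c"
      by (rule order_tendstoD(2)[OF tendsto_ident_at])
    moreover have "\<forall>\<^sub>F b in at a within S. b \<in> S"
      by (simp add: eventually_at_filter)
    ultimately show ?thesis
      by eventually_elim (use c mono in \<open>simp add: strict_mono_on_less\<close>)
  next
    case False
    then have "f b < u" if "b \<in> S" for b
      using interval[of "f a" "f b" u] that a u by force
    then show ?thesis
      by (simp add: eventually_at_filter)
  qed
qed

lemma strict_mono_on_inv_into:
  fixes f :: "'a::linorder \<Rightarrow> 'b::linorder"
  assumes "strict_mono_on S f"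
  shows "strict_mono_on (f ` S) (inv_into S f)"
proof (rule strict_mono_onI)
  fix u v assume "u \<in> f ` S" "v \<in> f ` S" "u < v"
  then show "inv_into S f u < inv_into S f v"
    using strict_mono_on_less[OF assms, of "inv_into S f u" "inv_into S f v"]
    by (simp add: inv_into_into f_inv_into_f)
qed

text \<open>The filters are punctured: continuity gives convergence to \<open>f a\<close>, and
  injectivity keeps \<open>f b\<close> away from \<open>f a\<close> when \<open>b\<close> differs
  from \<open>a\<close>.\<close>

lemma filterlim_at_within_inj_on:
  assumes "continuous_on S f" "inj_on f S" "a \<in> S"
  shows "filterlim f (at (f a) within f ` S) (at a within S)"
proof -
  have "(f \<longlongrightarrow> f a) (at a within S)"
    using assms(1,3) by (simp add: continuous_on_def)
  moreover have "\<forall>\<^sub>F b in at a within S. f b \<in> f ` S \<and> f b \<noteq> f a"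
    using assms(2,3) by (auto simp: eventually_at_filter inj_on_eq_iff)
  ultimately show ?thesis
    by (simp add: filterlim_at)
qed

text \<open>A homeomorphism matches punctured neighbourhoods, so each implication is a pullback
  along \<open>f\<close> or along its inverse.\<close>

lemma eventually_at_within_bij_betw:
  assumes bij: "bij_betw f S T"
    and cont: "continuous_on S f" "continuous_on T (inv_into S f)"
    and a: "a \<in> S"
  shows "(\<forall>\<^sub>F c in at (f a) within T. P c) \<longleftrightarrow> (\<forall>\<^sub>F b in at a within S. P (f b))"
proof
  have T: "f ` S = T" and inj: "inj_on f S"
    using bij by (auto simp: bij_betw_def)
  show "\<forall>\<^sub>F b in at a within S. P (f b)" if "\<forall>\<^sub>F c in at (f a) within T. P c"
    using eventually_compose_filterlim[OF that] filterlim_at_within_inj_on[OF cont(1) inj a]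
    by (simp add: T)
  have inv: "filterlim (inv_into S f) (at a within S) (at (f a) within T)"
    using filterlim_at_within_inj_on[OF cont(2), of "f a"] bij_betw_inv_into[OF bij] a inj T
    by (auto simp: bij_betw_def)
  \<comment> \<open>Pulling back along the inverse yields \<open>P (f (inv_into S f c))\<close>,
    which collapses to \<open>P c\<close> only for \<open>c\<close> in \<open>T\<close>.\<close>
  have "\<forall>\<^sub>F c in at (f a) within T. c \<in> T"
    by (simp add: eventually_at_filter)
  then show "\<forall>\<^sub>F c in at (f a) within T. P c" if "\<forall>\<^sub>F b in at a within S. P (f b)"
    using eventually_compose_filterlim[OF that inv]
    by eventually_elim (use T in \<open>simp add: f_inv_into_f\<close>)
qed

text \<open>Surjectivity supplies a preimage for each point above \<open>g \<alpha>\<close>, and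
  strict monotonicity reflects the order, which places that preimage above \<alpha>.\<close>

lemma strict_mono_bij_image_atLeastAtMost:
  fixes g :: "'a::linorder \<Rightarrow> 'b::linorder"
  assumes bij: "bij_betw g {a<..b} {c<..d}" and mono: "strict_mono_on {a<..b} g"
    and \<alpha>: "\<alpha> \<in> {a<..b}"
  shows "g ` {\<alpha>..b} = {g \<alpha>..d}"
proof (intro equalityI subsetI)
  fix v assume "v \<in> g ` {\<alpha>..b}"
  then obtain t where t: "t \<in> {\<alpha>..b}" "v = g t" by auto
  then have "t \<in> {a<..b}" using \<alpha> by auto
  then show "v \<in> {g \<alpha>..d}"
    using t \<alpha> bij_betwE[OF bij] strict_mono_on_leD[OF mono \<alpha>, of t] by auto
next
  fix v assume v: "v \<in> {g \<alpha>..d}"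
  then have "v \<in> {c<..d}"
    using bij_betwE[OF bij] \<alpha> by fastforce
  then obtain t where t: "t \<in> {a<..b}" "v = g t"
    using bij unfolding bij_betw_def by blast
  then show "v \<in> g ` {\<alpha>..b}"
    using v \<alpha> strict_mono_on_less_eq[OF mono \<alpha>, of t] by auto
qed

text \<open>At the top level the image of \<open>{b..b}\<close> is a single point, yet it equals
  \<open>{g b..d}\<close>, which contains \<open>d\<close>.\<close>

lemma strict_mono_bij_endpoint:
  fixes g :: "'a::linorder \<Rightarrow> 'b::linorder"
  assumes "bij_betw g {a<..b} {c<..d}" and "strict_mono_on {a<..b} g" and "a < b"
  shows "g b = d"
proof -
  have "{g b..d} = {g b}"
    using strict_mono_bij_image_atLeastAtMost[OF assms(1,2), of b] assms(3) by simp
  moreover have "g b \<le> d"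
    using bij_betwE[OF assms(1)] assms(3) by simp
  ultimately show ?thesis
    by (metis atLeastAtMost_iff order_refl singletonD)
qed

theorem proposition4p2:
  fixes scale :: "'k::real_normed_field \<Rightarrow> 'v::ab_group_add \<Rightarrow> 'v"
    and X :: "'v set"
    and x y :: "real \<Rightarrow> 'v"
    and g :: "real \<Rightarrow> real"
  assumes "vector_space scale"
    and "fuzzy_vector scale X x"
    and "bij_betw g {0<..1} {0<..1}"
    and "strict_mono_on {0<..1} g"
    and "\<And>t. t \<in> {0<..1} \<Longrightarrow> y t = x (g t)"
  shows "fuzzy_vector scale X y
    \<and> (\<forall>\<alpha>\<in>{0<..1}. tail_space scale y \<alpha> = tail_space scale x (g \<alpha>))
    \<and> tail_family scale y = tail_family scale x
    \<and> (\<forall>P :: (real \<Rightarrow> 'v) \<Rightarrow> bool.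
          (\<forall>u v. fuzzy_vector scale X u \<longrightarrow> fuzzy_vector scale X v \<longrightarrow>
             tail_family scale u = tail_family scale v \<longrightarrow> P u = P v)
          \<longrightarrow> P y = P x)
    \<and> (\<forall>\<alpha>\<in>{0<..1}. dim_profile scale y \<alpha> =o dim_profile scale x (g \<alpha>))
    \<and> bij_betw g (critical_levels scale y) (critical_levels scale x)
    \<and> strict_mono_on (critical_levels scale y) g"
proof -
  let ?I = "{0<..1::real}"
  have g_in: "g t \<in> ?I" if "t \<in> ?I" for t
    using bij_betwE[OF assms(3)] that by blast
  have g1: "g 1 = 1"
    using strict_mono_bij_endpoint[OF assms(3,4)] by simp
  have img: "g ` ?I = ?I"
    using assms(3) by (simp add: bij_betw_def)
  have fuzzy: "fuzzy_vector scale X y"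
  proof -
    obtain lab z where "fuzzy_labeling scale X lab" "z \<in> X" "\<forall>\<alpha>\<in>?I. x \<alpha> = lab \<alpha> z"
      using assms(2) unfolding fuzzy_vector_def by blast
    \<comment> \<open>The witness is the reparameterized labeling with the same base vector
      \<open>z\<close>; its normalization at level 1 is where \<open>g1\<close> enters.\<close>
    then show ?thesis
      unfolding fuzzy_vector_def using g_in g1 assms(5)
      by (intro exI[of _ "\<lambda>\<alpha>. lab (g \<alpha>)"] exI[of _ z]) (simp add: fuzzy_labeling_def)
  qed
  have tail: "tail_space scale y \<alpha> = tail_space scale x (g \<alpha>)" if "\<alpha> \<in> ?I" for \<alpha>
  proof -
    have "y ` {\<alpha>..1} = x ` g ` {\<alpha>..1}"
      unfolding image_image using that by (intro image_cong refl assms(5)) simp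
    then show ?thesis
      unfolding tail_space_def
      using strict_mono_bij_image_atLeastAtMost[OF assms(3,4) that] by simp
  qed
  have family: "tail_family scale y = tail_family scale x"
  proof -
    have "tail_space scale y ` ?I = tail_space scale x ` g ` ?I"
      unfolding image_image by (intro image_cong refl tail)
    then show ?thesis
      unfolding tail_family_def by (simp only: img)
  qed
  have dim: "dim_profile scale y \<alpha> = dim_profile scale x (g \<alpha>)" if "\<alpha> \<in> ?I" for \<alpha>
    using tail[OF that] by (simp add: dim_profile_def)
  \<comment> \<open>Both \<open>g\<close> and its inverse are increasing with the order-convex image
    \<open>?I\<close>, so monotonicity alone makes \<open>g\<close> a homeomorphism of
    \<open>?I\<close>.\<close>
  have cont: "continuous_on ?I g"
    using assms(4) by (rule continuous_on_strict_mono_interval_image) (auto simp: img)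
  have inv_img: "inv_into ?I g ` ?I = ?I"
    using bij_betw_inv_into[OF assms(3)] by (simp add: bij_betw_def)
  have cont_inv: "continuous_on ?I (inv_into ?I g)"
    using strict_mono_on_inv_into[OF assms(4)] unfolding img
    by (rule continuous_on_strict_mono_interval_image) (auto simp: inv_img)
  have critical: "\<alpha> \<in> critical_levels scale y \<longleftrightarrow> g \<alpha> \<in> critical_levels scale x"
    if \<alpha>: "\<alpha> \<in> ?I" for \<alpha>
  proof -
    \<comment> \<open>\<open>dim\<close> is known only on \<open>?I\<close>, which suffices because
      the filter is taken within \<open>?I\<close>.\<close>
    have "(\<forall>\<^sub>F \<beta> in at \<alpha> within ?I. dim_profile scale y \<beta> =o dim_profile scale y \<alpha>)
      \<longleftrightarrow> (\<forall>\<^sub>F \<beta> in at \<alpha> within ?I. dim_profile scale x (g \<beta>) =o dim_profile scale x (g \<alpha>))"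
      using dim \<alpha> by (auto simp: eventually_at_filter elim!: eventually_mono)
    also have "\<dots> \<longleftrightarrow>
        (\<forall>\<^sub>F \<gamma> in at (g \<alpha>) within ?I. dim_profile scale x \<gamma> =o dim_profile scale x (g \<alpha>))"
      by (rule eventually_at_within_bij_betw[OF assms(3) cont cont_inv \<alpha>, symmetric])
    finally show ?thesis
      using \<alpha> g_in[OF \<alpha>] by (simp add: critical_levels_def)
  qed
  have sub: "critical_levels scale u \<subseteq> ?I" for u
    by (auto simp: critical_levels_def)
  have "g ` critical_levels scale y = critical_levels scale x"
  proof (intro equalityI subsetI)
    fix c assume "c \<in> g ` critical_levels scale y"
    then show "c \<in> critical_levels scale x"
      using critical sub[of y] by blast
  next
    fix c assume c: "c \<in> critical_levels scale x"
    then obtain t where "t \<in> ?I" "c = g t"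
      using sub[of x] img by blast
    then show "c \<in> g ` critical_levels scale y"
      using critical c by blast
  qed
  then have bij: "bij_betw g (critical_levels scale y) (critical_levels scale x)"
    using bij_betw_subset[OF assms(3) sub] by blast
  have mono: "strict_mono_on (critical_levels scale y) g"
    using assms(4) sub by (rule monotone_on_subset)
  \<comment> \<open>Equal tail spaces give the same chosen basis, so only reflexivity of
    \<open>=o\<close> remains; unfolding \<open>cdim\<close> exposes the form \<open>|B|\<close> to
    which \<open>card_of_refl\<close> applies.\<close>
  have "dim_profile scale y \<alpha> =o dim_profile scale x (g \<alpha>)" if "\<alpha> \<in> ?I" for \<alpha>
    unfolding dim[OF that] by (simp add: dim_profile_def cdim_def card_of_refl)
  \<comment> \<open>The clause on arbitrary \<open>P\<close> is its own premise taken at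
    \<open>y\<close> and \<open>x\<close>, which are both fuzzy vectors over \<open>X\<close> with
    the same tail family.\<close>
  with fuzzy tail family bij mono assms(2) show ?thesis
    by blast
qed

end
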